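(* Let $G=(V,E)$ be a connected trivalent graph. Then the graph curve matroid $M_G$ is identically self-dual, i.e. its rank function coincides with that of its dual matroid, if and only if $G$ is $2$-edge-connected.
   Context: Graphs are finite and undirected and may have parallel edges and loops; trivalent means every vertex has degree $3$. For a graph $G=(V,E)$, let $r^*$ be the rank function of the bond (cographic) matroid of $G$, the dual of the cycle matroid. For $A\subseteq V$ let $\delta(A)$ be the set of edges incident to at least one vertex of $A$. The graph curve matroid $M_G$ is the matroid on ground set $V$ whose circuits are the non-empty subsets $A\subseteq V$ that are inclusion-minimal among non-empty subsets satisfying $r^*(\delta(A))\le|A|$. A matroid $M$ with rank function $\rho$ on ground set $V$ has dual rank function $\rho^*(A)=\rho(V- A)+|A|-\rho(V)$. $M$ is identically self-dual if $\rho=\rho^*$. *)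

theory Defs
  imports Main
begin

text \<open>
  Finite undirected graphs with parallel edges and loops. Edges are objects of their own, and
  \<open>ends G e\<close> is the set of end vertices of \<open>e\<close>: two vertices for an ordinary edge, one for a loop.
\<close>

record ('v, 'e) multigraph =
  verts :: "'v set"
  edges :: "'e set"
  ends :: "'e \<Rightarrow> 'v set"

definition finite_multigraph :: "('v, 'e) multigraph \<Rightarrow> bool" where
  "finite_multigraph G \<longleftrightarrow>
     finite (verts G) \<and> finite (edges G) \<and>
     (\<forall>e\<in>edges G. ends G e \<subseteq> verts G \<and> card (ends G e) \<in> {1, 2})"

text \<open>A loop contributes 2 to the degree of its vertex: it is counted in both summands.\<close>

definition degree :: "('v, 'e) multigraph \<Rightarrow> 'v \<Rightarrow> nat" where
  "degree G v = card {e \<in> edges G. v \<in> ends G e} + card {e \<in> edges G. ends G e = {v}}"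

definition trivalent :: "('v, 'e) multigraph \<Rightarrow> bool" where
  "trivalent G \<longleftrightarrow> (\<forall>v\<in>verts G. degree G v = 3)"

definition adj :: "('v, 'e) multigraph \<Rightarrow> ('v \<times> 'v) set" where
  "adj G = {(u, v). \<exists>e\<in>edges G. ends G e = {u, v}}"

definition connected_graph :: "('v, 'e) multigraph \<Rightarrow> bool" where
  "connected_graph G \<longleftrightarrow>
     verts G \<noteq> {} \<and> (\<forall>u\<in>verts G. \<forall>v\<in>verts G. (u, v) \<in> (adj G)\<^sup>*)"

definition delete_edges :: "('v, 'e) multigraph \<Rightarrow> 'e set \<Rightarrow> ('v, 'e) multigraph" where
  "delete_edges G F = G\<lparr>edges := edges G - F\<rparr>"

definition edge_connected :: "nat \<Rightarrow> ('v, 'e) multigraph \<Rightarrow> bool" where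
  "edge_connected k G \<longleftrightarrow>
     (\<forall>F\<subseteq>edges G. card F < k \<longrightarrow> connected_graph (delete_edges G F))"

text \<open>
  Rank function of the matroid whose set of circuits is \<open>\<C>\<close>: the independent sets are the sets
  containing no circuit, and the rank of a (finite) set is the largest size of an independent subset.
\<close>

definition circuit_rank :: "'a set set \<Rightarrow> 'a set \<Rightarrow> nat" where
  "circuit_rank \<C> A = Max (card ` {I. I \<subseteq> A \<and> \<not> (\<exists>C\<in>\<C>. C \<subseteq> I)})"

text \<open>The dual rank is integer-valued so that the subtraction is not truncated.\<close>

definition dual_rank :: "'a set \<Rightarrow> ('a set \<Rightarrow> nat) \<Rightarrow> 'a set \<Rightarrow> int" where
  "dual_rank S \<rho> A = int (\<rho> (S - A)) + int (card A) - int (\<rho> S)"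

definition identically_self_dual :: "'a set \<Rightarrow> ('a set \<Rightarrow> nat) \<Rightarrow> bool" where
  "identically_self_dual S \<rho> \<longleftrightarrow> (\<forall>A\<subseteq>S. int (\<rho> A) = dual_rank S \<rho> A)"

text \<open>
  Edge sets of cycles, the circuits of the cycle matroid. A cycle of length 1 is a loop and a cycle
  of length 2 is a pair of distinct parallel edges.
\<close>

definition cycles :: "('v, 'e) multigraph \<Rightarrow> 'e set set" where
  "cycles G = {set es | es vs.
     es \<noteq> [] \<and> length vs = length es \<and> distinct es \<and> distinct vs \<and>
     set es \<subseteq> edges G \<and> set vs \<subseteq> verts G \<and>
     (\<forall>i<length es. ends G (es ! i) = {vs ! i, vs ! (Suc i mod length es)})}"

definition cycle_rank :: "('v, 'e) multigraph \<Rightarrow> 'e set \<Rightarrow> nat" where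
  "cycle_rank G = circuit_rank (cycles G)"

definition bond_rank :: "('v, 'e) multigraph \<Rightarrow> 'e set \<Rightarrow> int" where
  "bond_rank G = dual_rank (edges G) (cycle_rank G)"

definition incident_edges :: "('v, 'e) multigraph \<Rightarrow> 'v set \<Rightarrow> 'e set" where
  "incident_edges G A = {e \<in> edges G. ends G e \<inter> A \<noteq> {}}"

definition gcm_small :: "('v, 'e) multigraph \<Rightarrow> 'v set \<Rightarrow> bool" where
  "gcm_small G A \<longleftrightarrow>
     A \<subseteq> verts G \<and> A \<noteq> {} \<and> bond_rank G (incident_edges G A) \<le> int (card A)"

text \<open>Circuits and rank function of the graph curve matroid of \<open>G\<close>, whose ground set is \<open>verts G\<close>.\<close>

definition gcm_circuits :: "('v, 'e) multigraph \<Rightarrow> 'v set set" where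
  "gcm_circuits G = {A. gcm_small G A \<and> (\<forall>B. B \<subset> A \<longrightarrow> \<not> gcm_small G B)}"

definition gcm_rank :: "('v, 'e) multigraph \<Rightarrow> 'v set \<Rightarrow> nat" where
  "gcm_rank G = circuit_rank (gcm_circuits G)"

end

theory Submission imports Defs begin

text \<open>
  Write \<open>c(S)\<close> for the number of components of the subgraph induced by \<open>S\<close>, and \<open>\<delta>(A)\<close> for the edges
  meeting \<open>A\<close>. Then \<open>f(A) = r\<^sup>*(\<delta>(A)) - 1 = |\<delta>(A)| - |A| - c(V - A)\<close> is monotone and submodular, and \<open>I\<close> is
  independent in the graph curve matroid iff \<open>|A| \<le> f(A)\<close> for all non-empty \<open>A \<subseteq> I\<close>.

  If there is no bridge, every component of \<open>V - W\<close> sends at least two edges to \<open>W\<close>, so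
  \<open>f(W) \<ge> |W|/2\<close>; an uncrossing argument then shows that all maximal independent sets have \<open>|V|/2\<close>
  elements. A double count of components shows that the complement of an independent set of size
  \<open>|V|/2\<close> is independent, which gives self-duality. Conversely, a self-dual matroid has rank
  \<open>|V|/2\<close>, whereas a bridge splits \<open>V\<close> into two parts \<open>C\<close> each of rank at most \<open>(|C| - 1)/2\<close>.
\<close>

section \<open>Connectivity by a set of edges\<close>

definition conn :: "('v, 'e) multigraph \<Rightarrow> 'e set \<Rightarrow> ('v \<times> 'v) set" where
  "conn G X = {(u, v). \<exists>e\<in>X. ends G e = {u, v}}\<^sup>*"

definition component :: "('v, 'e) multigraph \<Rightarrow> 'e set \<Rightarrow> 'v \<Rightarrow> 'v set" where
  "component G X v = conn G X `` {v}"

definition ncomp :: "('v, 'e) multigraph \<Rightarrow> 'e set \<Rightarrow> nat" where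
  "ncomp G X = card (component G X ` verts G)"

definition induced_edges :: "('v, 'e) multigraph \<Rightarrow> 'v set \<Rightarrow> 'e set" where
  "induced_edges G S = {e \<in> edges G. ends G e \<subseteq> S}"

lemma conn_refl [simp]: "(v, v) \<in> conn G X"
  by (simp add: conn_def)

lemma conn_sym: "(u, v) \<in> conn G X \<Longrightarrow> (v, u) \<in> conn G X"
  unfolding conn_def by (rule symD[OF sym_rtrancl]) (auto simp: sym_def insert_commute)

lemma conn_trans: "(u, v) \<in> conn G X \<Longrightarrow> (v, w) \<in> conn G X \<Longrightarrow> (u, w) \<in> conn G X"
  unfolding conn_def by (rule rtrancl_trans)

lemma conn_mono: "X \<subseteq> Y \<Longrightarrow> conn G X \<subseteq> conn G Y"
  unfolding conn_def by (rule rtrancl_mono) auto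

lemma conn_edge: "e \<in> X \<Longrightarrow> ends G e = {u, v} \<Longrightarrow> (u, v) \<in> conn G X"
  unfolding conn_def by blast

text \<open>Induction along a walk. The closure hypothesis covers both directions of an edge,
  because \<open>{x, y} = {y, x}\<close>. This is how components are bounded from above
  throughout.\<close>

lemma conn_closed:
  assumes "(u, v) \<in> conn G X" "u \<in> T"
    and "\<And>e x y. e \<in> X \<Longrightarrow> ends G e = {x, y} \<Longrightarrow> x \<in> T \<Longrightarrow> y \<in> T"
  shows "v \<in> T"
  using assms(1) unfolding conn_def
  by (induction rule: rtrancl_induct) (use assms(2,3) in auto)

lemma mem_component_iff: "w \<in> component G X v \<longleftrightarrow> (v, w) \<in> conn G X"
  by (simp add: component_def)

lemma component_self [simp]: "v \<in> component G X v"
  by (simp add: mem_component_iff)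

lemma component_eq_iff: "component G X u = component G X v \<longleftrightarrow> (u, v) \<in> conn G X"
  unfolding set_eq_iff mem_component_iff by (metis conn_refl conn_sym conn_trans)

lemma component_eqI: "w \<in> component G X v \<Longrightarrow> component G X w = component G X v"
  by (simp add: mem_component_iff component_eq_iff conn_sym)

text \<open>The union of the two old components is closed under the old edges and \<open>e\<close>,
  while a component that contains neither end never meets \<open>e\<close>. If \<open>e\<close> is a
  loop or joins connected vertices, the union is a single old component.\<close>

lemma component_insert:
  assumes e: "ends G e = {a, b}"
  shows "component G (insert e X) v =
    (if v \<in> component G X a \<union> component G X b then component G X a \<union> component G X b else component G X v)"
proof -
  have ab: "(a, b) \<in> conn G (insert e X)"
    by (rule conn_edge[OF insertI1 e])
  have m: "conn G X \<subseteq> conn G (insert e X)" by (rule conn_mono) auto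
  show ?thesis
  proof (cases "v \<in> component G X a \<union> component G X b")
    case True
    have "w \<in> component G X a \<union> component G X b" if "(v, w) \<in> conn G (insert e X)" for w
      using that True
    proof (rule conn_closed)
      fix d x y
      assume "d \<in> insert e X" "ends G d = {x, y}" "x \<in> component G X a \<union> component G X b"
      then show "y \<in> component G X a \<union> component G X b"
        using e conn_edge[of d X G x y] conn_trans[of a x G X y] conn_trans[of b x G X y]
        by (auto simp: mem_component_iff doubleton_eq_iff)
    qed
    moreover have "(v, w) \<in> conn G (insert e X)" if "w \<in> component G X a \<union> component G X b" for w
    proof -
      have "(a, v) \<in> conn G (insert e X)" "(a, w) \<in> conn G (insert e X)"
        using True that m ab conn_trans[OF ab] unfolding mem_component_iff Un_iff by blast+
      then show ?thesis by (blast intro: conn_trans conn_sym)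
    qed
    ultimately have "component G (insert e X) v = component G X a \<union> component G X b"
      unfolding set_eq_iff mem_component_iff[of _ G "insert e X"] by blast
    then show ?thesis using True by simp
  next
    case False
    have "w \<in> component G X v" if "(v, w) \<in> conn G (insert e X)" for w
      using that component_self
    proof (rule conn_closed)
      fix d x y
      assume "d \<in> insert e X" "ends G d = {x, y}" "x \<in> component G X v"
      then show "y \<in> component G X v"
        using e False conn_edge[of d X G x y] conn_trans[of v x G X y]
          conn_sym[of v a G X] conn_sym[of v b G X]
        by (auto simp: mem_component_iff doubleton_eq_iff)
    qed
    then have "component G (insert e X) v = component G X v"
      using m unfolding set_eq_iff mem_component_iff by blast
    then show ?thesis using False by simp
  qed
qed

section \<open>Number of components as a function of the edge set\<close>

locale fin_multigraph =
  fixes G :: "('v, 'e) multigraph"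
  assumes finite_multigraph: "finite_multigraph G"
begin

lemma finite_verts [simp]: "finite (verts G)" and finite_edges [simp]: "finite (edges G)"
  and ends_subset: "e \<in> edges G \<Longrightarrow> ends G e \<subseteq> verts G"
  using finite_multigraph by (auto simp: finite_multigraph_def)

lemma finite_vsubset: "S \<subseteq> verts G \<Longrightarrow> finite S"
  by (rule finite_subset[OF _ finite_verts])

lemma finite_esubset: "X \<subseteq> edges G \<Longrightarrow> finite X"
  by (rule finite_subset[OF _ finite_edges])

lemma ends_cases:
  assumes "e \<in> edges G"
  obtains a b where "ends G e = {a, b}" "a \<in> verts G" "b \<in> verts G"
proof -
  have "card (ends G e) = 1 \<or> card (ends G e) = 2"
    using finite_multigraph assms by (auto simp: finite_multigraph_def)
  then obtain a b where "ends G e = {a, b}"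
    by (metis card_1_singletonE card_2_iff insert_absorb2)
  with ends_subset[OF assms] that show ?thesis by auto
qed

lemma component_subset:
  assumes "X \<subseteq> edges G" "v \<in> verts G"
  shows "component G X v \<subseteq> verts G"
proof
  fix w assume "w \<in> component G X v"
  then have "(v, w) \<in> conn G X" by (simp add: mem_component_iff)
  then show "w \<in> verts G"
    by (rule conn_closed) (use assms ends_subset in auto)
qed

lemma ncomp_insert:
  assumes e: "ends G e = {a, b}" and V: "a \<in> verts G" "b \<in> verts G"
  shows "ncomp G (insert e X) + (if (a, b) \<in> conn G X then 0 else 1) = ncomp G X"
proof -
  let ?Q = "component G X ` verts G" and ?Ka = "component G X a" and ?Kb = "component G X b"
  have Q': "component G (insert e X) ` verts G = insert (?Ka \<union> ?Kb) (?Q - {?Ka, ?Kb})" (is "?L = ?R")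
  proof
    show "?L \<subseteq> ?R"
    proof clarify
      fix v assume v: "v \<in> verts G" and *: "component G (insert e X) v \<notin> ?Q - {?Ka, ?Kb}"
      show "component G (insert e X) v = ?Ka \<union> ?Kb"
      proof (rule ccontr)
        assume "component G (insert e X) v \<noteq> ?Ka \<union> ?Kb"
        then have "v \<notin> ?Ka \<union> ?Kb" "component G (insert e X) v = component G X v"
          unfolding component_insert[OF e] by (auto split: if_splits)
        then show False using * v component_self[of v G X] by auto
      qed
    qed
    show "?R \<subseteq> ?L"
    proof
      fix K assume "K \<in> ?R"
      then consider "K = ?Ka \<union> ?Kb" | v where "v \<in> verts G" "K = component G X v" "K \<noteq> ?Ka" "K \<noteq> ?Kb"
        by auto
      then show "K \<in> ?L"
      proof cases
        case 1
        then have "K = component G (insert e X) a" by (simp add: component_insert[OF e])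
        then show ?thesis using V by auto
      next
        case 2
        then have "v \<notin> ?Ka \<union> ?Kb" using component_eqI[of v G X] by auto
        then have "K = component G (insert e X) v" using 2 by (simp add: component_insert[OF e])
        then show ?thesis using 2 by auto
      qed
    qed
  qed
  \<comment> \<open>A class equal to the union contains \<open>a\<close>, hence is
    \<open>?Ka\<close>, which has just been removed.\<close>
  have new: "?Ka \<union> ?Kb \<notin> ?Q - {?Ka, ?Kb}"
  proof
    assume *: "?Ka \<union> ?Kb \<in> ?Q - {?Ka, ?Kb}"
    then obtain v where v: "?Ka \<union> ?Kb = component G X v" by auto
    then have "a \<in> component G X v" using component_self[of a G X] by blast
    then have "?Ka = component G X v" by (rule component_eqI)
    with v * show False by auto
  qed
  have fin: "finite ?Q" by simp
  have "ncomp G (insert e X) = Suc (card (?Q - {?Ka, ?Kb}))"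
    unfolding ncomp_def Q' using new fin by (subst card_insert_disjoint) auto
  also have "card (?Q - {?Ka, ?Kb}) = card ?Q - card {?Ka, ?Kb}"
    using V by (intro card_Diff_subset) auto
  finally have *: "ncomp G (insert e X) = Suc (ncomp G X - card {?Ka, ?Kb})"
    by (simp add: ncomp_def)
  have "card {?Ka, ?Kb} \<le> ncomp G X"
    unfolding ncomp_def using V by (intro card_mono) auto
  moreover have "card {?Ka, ?Kb} = (if (a, b) \<in> conn G X then 1 else 2)"
    by (simp add: component_eq_iff[symmetric])
  ultimately show ?thesis using * by (auto split: if_splits)
qed

lemma ncomp_insert_edge:
  assumes "e \<in> edges G"
  shows "ncomp G (insert e X) \<le> ncomp G X" "ncomp G X \<le> Suc (ncomp G (insert e X))"
proof -
  obtain a b where ab: "ends G e = {a, b}" "a \<in> verts G" "b \<in> verts G"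
    using ends_cases[OF assms] .
  show "ncomp G (insert e X) \<le> ncomp G X" "ncomp G X \<le> Suc (ncomp G (insert e X))"
    using ncomp_insert[OF ab, of X] by (auto split: if_splits)
qed

lemma ncomp_antimono:
  assumes "X \<subseteq> Y" "Y \<subseteq> edges G"
  shows "ncomp G Y \<le> ncomp G X"
proof -
  have "ncomp G (X \<union> Z) \<le> ncomp G X" if "finite Z" "Z \<subseteq> edges G" for Z
    using that
  proof (induction rule: finite_induct)
    case (insert e Z)
    then show ?case using ncomp_insert_edge(1)[of e "X \<union> Z"] by simp
  qed simp
  from this[of Y] show ?thesis using assms finite_esubset by (simp add: Un_absorb1)
qed

text \<open>A new edge merges at most two components. Up to the constant
  \<open>card (verts G)\<close>, the quantity is the nullity of the edge set.\<close>

lemma ncomp_plus_card_mono: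
  assumes "X \<subseteq> Y" "Y \<subseteq> edges G"
  shows "ncomp G X + card X \<le> ncomp G Y + card Y"
proof -
  have "ncomp G X + card X \<le> ncomp G (X \<union> Z) + card (X \<union> Z)"
    if "finite Z" "Z \<subseteq> edges G" for Z
    using that
  proof (induction rule: finite_induct)
    case (insert e Z)
    have "finite (X \<union> Z)" using assms insert finite_esubset by (metis finite_UnI finite_subset)
    then show ?case using insert ncomp_insert_edge[of e "X \<union> Z"]
      by (auto simp: card_insert_if insert_absorb)
  qed simp
  from this[of Y] show ?thesis using assms finite_esubset by (simp add: Un_absorb1)
qed

text \<open>Submodularity of the cycle rank in terms of components: when edges are added one at a
  time, an edge that merges two components over the larger set \<open>Y \<union> Z\<close> also
  merges two over the smaller set.\<close>

lemma ncomp_supermodular: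
  assumes "X \<subseteq> edges G" "Y \<subseteq> edges G"
  shows "ncomp G X + ncomp G Y \<le> ncomp G (X \<inter> Y) + ncomp G (X \<union> Y)"
proof -
  have "ncomp G ((X \<inter> Y) \<union> Z) + ncomp G Y \<le> ncomp G (X \<inter> Y) + ncomp G (Y \<union> Z)"
    if "finite Z" "Z \<subseteq> edges G" for Z
    using that
  proof (induction rule: finite_induct)
    case (insert e Z)
    obtain a b where ab: "ends G e = {a, b}" "a \<in> verts G" "b \<in> verts G"
      using ends_cases[of e] insert by blast
    have "conn G ((X \<inter> Y) \<union> Z) \<subseteq> conn G (Y \<union> Z)" by (rule conn_mono) auto
    then show ?case
      using insert ncomp_insert[OF ab, of "(X \<inter> Y) \<union> Z"] ncomp_insert[OF ab, of "Y \<union> Z"]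
      by (auto split: if_splits)
  qed simp
  from this[of X] assms show ?thesis
    by (simp add: finite_esubset Un_absorb1 Un_commute)
qed

lemma ncomp_empty: "ncomp G {} = card (verts G)"
proof -
  have "component G {} v = {v}" for v by (auto simp: component_def conn_def)
  then show ?thesis by (simp add: ncomp_def card_image)
qed

end

section \<open>Rank functions of the cycle, bond and graph curve matroids\<close>

lemma circuit_rank_witness:
  assumes "finite A" "{} \<notin> \<C>"
  obtains I where "I \<subseteq> A" "\<not> (\<exists>C\<in>\<C>. C \<subseteq> I)" "card I = circuit_rank \<C> A"
proof -
  let ?S = "{I. I \<subseteq> A \<and> \<not> (\<exists>C\<in>\<C>. C \<subseteq> I)}"
  have "finite ?S" using assms(1) by simp
  moreover have "{} \<in> ?S" using assms(2) by auto
  ultimately have "circuit_rank \<C> A \<in> card ` ?S"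
    unfolding circuit_rank_def by (intro Max_in) auto
  with that show ?thesis by auto
qed

lemma card_le_circuit_rank:
  assumes "finite A" "I \<subseteq> A" "\<not> (\<exists>C\<in>\<C>. C \<subseteq> I)"
  shows "card I \<le> circuit_rank \<C> A"
proof -
  have "finite {I. I \<subseteq> A \<and> \<not> (\<exists>C\<in>\<C>. C \<subseteq> I)}"
    using assms(1) by simp
  then show ?thesis
    unfolding circuit_rank_def using assms by (intro Max_ge) auto
qed

text \<open>The path is extended step by step, and cut back to the earlier occurrence when it
  returns to a visited vertex. The one-vertex path covers \<open>a = b\<close>.\<close>

lemma conn_imp_simple_path:
  assumes "(a, b) \<in> conn G X"
  shows "\<exists>vs. vs \<noteq> [] \<and> hd vs = a \<and> last vs = b \<and> distinct vs \<and>
    (\<forall>i. Suc i < length vs \<longrightarrow> (\<exists>e\<in>X. ends G e = {vs ! i, vs ! Suc i}))"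
  using assms unfolding conn_def
proof (induction rule: rtrancl_induct)
  case base
  show ?case by (rule exI[of _ "[a]"]) simp
next
  case (step y z)
  then obtain vs e where vs: "vs \<noteq> []" "hd vs = a" "last vs = y" "distinct vs"
      "\<And>i. Suc i < length vs \<Longrightarrow> \<exists>e\<in>X. ends G e = {vs ! i, vs ! Suc i}"
    and e: "e \<in> X" "ends G e = {y, z}"
    by auto
  show ?case
  proof (cases "z \<in> set vs")
    case True
    then obtain k where k: "Suc k \<le> length vs" "vs ! k = z" by (auto simp: in_set_conv_nth Suc_le_eq)
    then show ?thesis using vs
      by (intro exI[of _ "take (Suc k) vs"]) (auto simp: hd_conv_nth last_conv_nth min_absorb2)
  next
    case False
    have "\<exists>d\<in>X. ends G d = {(vs @ [z]) ! i, (vs @ [z]) ! Suc i}" if "Suc i < length (vs @ [z])" for i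
    proof (cases "Suc i < length vs")
      case True
      then show ?thesis using vs(5)[of i] by (auto simp: nth_append)
    next
      case False
      then have "i = length vs - 1" using that by auto
      then have "(vs @ [z]) ! i = y" "(vs @ [z]) ! Suc i = z"
        using vs(1,3) by (auto simp: nth_append last_conv_nth)
      then show ?thesis using e by auto
    qed
    then show ?thesis using vs False by (intro exI[of _ "vs @ [z]"]) auto
  qed
qed

section \<open>Cycles, spanning forests and the cycle rank\<close>

context fin_multigraph
begin

text \<open>\<open>e\<close> closes a simple path from \<open>a\<close> to \<open>b\<close> in
  \<open>X\<close>. A path with one vertex yields a loop, one with a single edge a pair of parallel
  edges.\<close>

lemma cycle_through_edge:
  assumes X: "X \<subseteq> edges G" and e: "e \<in> edges G" "e \<notin> X" "ends G e = {a, b}"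
    and conn: "(a, b) \<in> conn G X"
  shows "\<exists>C\<in>cycles G. C \<subseteq> insert e X"
proof -
  obtain vs where vs: "vs \<noteq> []" "hd vs = a" "last vs = b" "distinct vs"
      "\<And>i. Suc i < length vs \<Longrightarrow> \<exists>d\<in>X. ends G d = {vs ! i, vs ! Suc i}"
    using conn_imp_simple_path[OF conn] by blast
  define n where "n = length vs - 1"
  have len: "length vs = Suc n" using vs(1) by (simp add: n_def)
  have a: "vs ! 0 = a" and b: "vs ! n = b"
    using vs by (auto simp: hd_conv_nth last_conv_nth n_def)
  obtain d where d: "\<And>i. i < n \<Longrightarrow> d i \<in> X \<and> ends G (d i) = {vs ! i, vs ! Suc i}"
    using vs(5) len by (metis Suc_less_eq)
  have inj: "inj_on d {..<n}"
  proof (rule inj_onI)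
    fix i j assume ij: "i \<in> {..<n}" "j \<in> {..<n}" "d i = d j"
    then have "{vs ! i, vs ! Suc i} = {vs ! j, vs ! Suc j}" using d by (metis lessThan_iff)
    then show "i = j"
      using ij vs(4) len by (auto simp: doubleton_eq_iff nth_eq_iff_index_eq)
  qed
  \<comment> \<open>\<open>e\<close> comes last, so that the index
    \<open>Suc n mod Suc n = 0\<close> leads from \<open>b\<close> back to \<open>a\<close>.\<close>
  define es where "es = map d [0..<n] @ [e]"
  have es: "length es = Suc n" "set es = insert e (d ` {..<n})"
    by (auto simp: es_def)
  have "distinct es"
    using inj e d by (auto simp: es_def distinct_map atLeast0LessThan)
  moreover have "ends G (es ! i) = {vs ! i, vs ! (Suc i mod length es)}" if "i < length es" for i
  proof (cases "i < n")
    case True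
    then show ?thesis using d es by (simp add: es_def nth_append)
  next
    case False
    then have "i = n" using that es by simp
    then show ?thesis using e(3) a b es by (auto simp: es_def nth_append insert_commute)
  qed
  moreover have "set es \<subseteq> edges G" using es X e d by auto
  moreover have "set vs \<subseteq> verts G"
  proof
    fix v assume "v \<in> set vs"
    then obtain i where i: "i < Suc n" "v = vs ! i" using len by (auto simp: in_set_conv_nth)
    show "v \<in> verts G"
    proof (cases "i < n")
      case True
      then show ?thesis using i d[of i] X ends_subset by blast
    next
      case False
      then show ?thesis using i b e ends_subset by (metis insert_subset less_SucE)
    qed
  qed
  ultimately have "set es \<in> cycles G"
    unfolding cycles_def using vs(4) es len by (intro CollectI exI[of _ es] exI[of _ vs]) auto
  then show ?thesis using es d by (intro bexI[of _ "set es"]) auto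
qed

text \<open>The other edges of the cycle form a path between the ends of its last edge. For a loop
  that path is trivial, and reflexivity of \<open>conn\<close> suffices.\<close>

lemma cycle_has_redundant_edge:
  assumes "C \<in> cycles G"
  obtains e a b where "e \<in> C" "ends G e = {a, b}" "(a, b) \<in> conn G (C - {e})"
proof -
  obtain es vs where C: "C = set es" "es \<noteq> []" "length vs = length es" "distinct es"
    and ends: "\<And>i. i < length es \<Longrightarrow> ends G (es ! i) = {vs ! i, vs ! (Suc i mod length es)}"
    using assms by (auto simp: cycles_def)
  define n where "n = length es - 1"
  have n: "length es = Suc n" using C by (simp add: n_def)
  have "i \<le> n \<Longrightarrow> (vs ! 0, vs ! i) \<in> conn G (C - {es ! n})" for i
  proof (induction i)
    case (Suc i)
    then have "es ! i \<in> C - {es ! n}" "ends G (es ! i) = {vs ! i, vs ! Suc i}"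
      using C n ends[of i] by (auto simp: nth_eq_iff_index_eq)
    then have "(vs ! i, vs ! Suc i) \<in> conn G (C - {es ! n})" by (rule conn_edge)
    with Suc show ?case by (auto intro: conn_trans)
  qed simp
  from this[of n] have "(vs ! 0, vs ! n) \<in> conn G (C - {es ! n})" by simp
  moreover have "ends G (es ! n) = {vs ! 0, vs ! n}" "es ! n \<in> C"
    using ends[of n] n C by (auto simp: insert_commute)
  ultimately show ?thesis using that by blast
qed

lemma cycles_nonempty: "{} \<notin> cycles G"
  by (auto simp: cycles_def)

text \<open>Each new edge joins two different components, since otherwise it would close a
  cycle.\<close>

lemma acyclic_ncomp:
  assumes "X \<subseteq> edges G" "\<not> (\<exists>C\<in>cycles G. C \<subseteq> X)"
  shows "ncomp G X + card X = card (verts G)"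
  using finite_esubset[OF assms(1)] assms
proof (induction rule: finite_induct)
  case (insert e X)
  obtain a b where ab: "ends G e = {a, b}" "a \<in> verts G" "b \<in> verts G"
    using ends_cases insert.prems by blast
  have "(a, b) \<notin> conn G X"
    using cycle_through_edge[of X e a b] ab insert by auto
  then have "ncomp G (insert e X) + 1 = ncomp G X" using ncomp_insert[OF ab, of X] by simp
  moreover have "\<not> (\<exists>C\<in>cycles G. C \<subseteq> X)" using insert.prems by blast
  ultimately show ?case using insert by simp
qed (simp add: ncomp_empty)

text \<open>A subset of least size with the same number of components is acyclic: an edge of a cycle
  could be dropped without changing the count.\<close>

lemma spanning_acyclic:
  assumes "X \<subseteq> edges G"
  obtains F where "F \<subseteq> X" "ncomp G F = ncomp G X" "\<not> (\<exists>C\<in>cycles G. C \<subseteq> F)"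
proof -
  define F where "F = arg_min card (\<lambda>F. F \<subseteq> X \<and> ncomp G F = ncomp G X)"
  have F: "F \<subseteq> X" "ncomp G F = ncomp G X"
    and min: "\<And>F'. F' \<subseteq> X \<Longrightarrow> ncomp G F' = ncomp G X \<Longrightarrow> card F \<le> card F'"
    using arg_min_nat_lemma[of "\<lambda>F. F \<subseteq> X \<and> ncomp G F = ncomp G X" X card]
    unfolding F_def by blast+
  have "\<not> C \<subseteq> F" if "C \<in> cycles G" for C
  proof
    assume CF: "C \<subseteq> F"
    obtain e a b where e: "e \<in> C" "ends G e = {a, b}" "(a, b) \<in> conn G (C - {e})"
      using cycle_has_redundant_edge[OF \<open>C \<in> cycles G\<close>] .
    have eE: "e \<in> edges G" using e CF F assms by auto
    have "(a, b) \<in> conn G (F - {e})" using e(3) conn_mono[of "C - {e}" "F - {e}" G] CF by blast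
    then have "ncomp G (insert e (F - {e})) = ncomp G (F - {e})"
      using ncomp_insert[of e a b "F - {e}"] e(2) ends_subset[OF eE] by auto
    then have "ncomp G (F - {e}) = ncomp G X" using F e CF by (auto simp: insert_absorb)
    then have "card F \<le> card (F - {e})" using min F by blast
    moreover have "finite F" using F assms finite_esubset by blast
    ultimately show False using e CF card_Diff1_less[of F e] by auto
  qed
  with F that show ?thesis by blast
qed

text \<open>A spanning forest attains the value, and no acyclic subset exceeds it, since a subset
  has at least as many components. From here on cycle and bond ranks are handled through component
  counts.\<close>

lemma cycle_rank_eq:
  assumes "X \<subseteq> edges G"
  shows "cycle_rank G X + ncomp G X = card (verts G)"
proof -
  obtain I where I: "I \<subseteq> X" "\<not> (\<exists>C\<in>cycles G. C \<subseteq> I)" "card I = cycle_rank G X"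
    unfolding cycle_rank_def
    using circuit_rank_witness[OF finite_esubset[OF assms] cycles_nonempty] .
  obtain F where F: "F \<subseteq> X" "ncomp G F = ncomp G X" "\<not> (\<exists>C\<in>cycles G. C \<subseteq> F)"
    using spanning_acyclic[OF assms] .
  have "card F \<le> cycle_rank G X"
    unfolding cycle_rank_def using F finite_esubset[OF assms] by (intro card_le_circuit_rank) auto
  then show ?thesis
    using I F acyclic_ncomp[of I] acyclic_ncomp[of F] ncomp_antimono[of I X] assms
    by (simp add: subset_trans[OF _ assms])
qed

lemma bond_rank_eq:
  assumes "X \<subseteq> edges G"
  shows "bond_rank G X = int (card X) + int (ncomp G (edges G)) - int (ncomp G (edges G - X))"
  using cycle_rank_eq[of "edges G - X"] cycle_rank_eq[of "edges G"]
  by (simp add: bond_rank_def dual_rank_def)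

section \<open>Independent sets and rank of the graph curve matroid\<close>

definition gcm_indep :: "'v set \<Rightarrow> bool" where
  "gcm_indep I \<longleftrightarrow> I \<subseteq> verts G \<and> (\<forall>A\<subseteq>I. A \<noteq> {} \<longrightarrow> \<not> gcm_small G A)"

text \<open>A small subset of \<open>I\<close> of least size is a circuit, so minimality can be
  ignored when testing independence.\<close>

lemma gcm_indep_iff:
  assumes "I \<subseteq> verts G"
  shows "gcm_indep I \<longleftrightarrow> \<not> (\<exists>C\<in>gcm_circuits G. C \<subseteq> I)"
proof
  assume "gcm_indep I"
  then show "\<not> (\<exists>C\<in>gcm_circuits G. C \<subseteq> I)"
    by (auto simp: gcm_indep_def gcm_circuits_def gcm_small_def)
next
  assume *: "\<not> (\<exists>C\<in>gcm_circuits G. C \<subseteq> I)"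
  have "\<not> gcm_small G A" if "A \<subseteq> I" for A
  proof
    assume "gcm_small G A"
    define C where "C = arg_min card (\<lambda>A. A \<subseteq> I \<and> gcm_small G A)"
    have C: "C \<subseteq> I" "gcm_small G C"
      and min: "\<And>B. B \<subseteq> I \<Longrightarrow> gcm_small G B \<Longrightarrow> card C \<le> card B"
      using arg_min_nat_lemma[of "\<lambda>A. A \<subseteq> I \<and> gcm_small G A" A card] that \<open>gcm_small G A\<close>
      unfolding C_def by blast+
    have "\<not> gcm_small G B" if "B \<subset> C" for B
      using psubset_card_mono[OF _ that] finite_vsubset[of C] C assms min[of B] that by fastforce
    then have "C \<in> gcm_circuits G" using C by (simp add: gcm_circuits_def)
    with * C show False by blast
  qed
  then show "gcm_indep I" using assms by (simp add: gcm_indep_def)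
qed

lemma gcm_rank_witness:
  assumes "A \<subseteq> verts G"
  obtains I where "I \<subseteq> A" "gcm_indep I" "card I = gcm_rank G A"
proof -
  have "{} \<notin> gcm_circuits G" by (auto simp: gcm_circuits_def gcm_small_def)
  then obtain I where "I \<subseteq> A" "\<not> (\<exists>C\<in>gcm_circuits G. C \<subseteq> I)" "card I = gcm_rank G A"
    unfolding gcm_rank_def using circuit_rank_witness[OF finite_vsubset[OF assms]] by metis
  with that show ?thesis using assms gcm_indep_iff[of I] by auto
qed

lemma card_le_gcm_rank:
  assumes "A \<subseteq> verts G" "I \<subseteq> A" "gcm_indep I"
  shows "card I \<le> gcm_rank G A"
  unfolding gcm_rank_def using assms gcm_indep_iff[of I] finite_vsubset
  by (intro card_le_circuit_rank) auto

end

section \<open>The rank bound of the graph curve matroid\<close>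

text \<open>The image runs over \<open>S\<close> only: vertices outside \<open>S\<close> are
  isolated in \<open>induced_edges G S\<close> and would add spurious singletons.\<close>

definition components :: "('v, 'e) multigraph \<Rightarrow> 'v set \<Rightarrow> 'v set set" where
  "components G S = component G (induced_edges G S) ` S"

locale connected_trivalent = fin_multigraph G for G :: "('v, 'e) multigraph" +
  assumes connected: "connected_graph G" and trivalent: "trivalent G"
begin

lemma induced_edges_subset: "induced_edges G S \<subseteq> edges G"
  and incident_edges_subset: "incident_edges G S \<subseteq> edges G"
  by (auto simp: induced_edges_def incident_edges_def)

lemma edges_minus_incident: "edges G - incident_edges G S = induced_edges G (verts G - S)"
  using ends_subset by (auto simp: induced_edges_def incident_edges_def)

text \<open>Degree count: an edge contributes its number of ends in \<open>S\<close>, once for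
  meeting \<open>S\<close> and once more for lying inside. A loop at a vertex of \<open>S\<close>
  contributes twice.\<close>

lemma card_incident_plus_induced:
  assumes "S \<subseteq> verts G"
  shows "card (incident_edges G S) + card (induced_edges G S) = 3 * card S"
proof -
  have finS: "finite S" by (rule finite_vsubset[OF assms])
  have "3 * card S = (\<Sum>v\<in>S. degree G v)"
    using trivalent assms by (subst sum.cong[of S S _ "\<lambda>_. 3"]) (auto simp: trivalent_def)
  also have "\<dots> = (\<Sum>v\<in>S. \<Sum>e\<in>edges G. of_bool (v \<in> ends G e) + of_bool (ends G e = {v}))"
    by (simp add: degree_def sum.distrib Int_def)
  also have "\<dots> = (\<Sum>e\<in>edges G. \<Sum>v\<in>S. of_bool (v \<in> ends G e) + of_bool (ends G e = {v}))"
    by (rule sum.swap)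
  also have "\<dots> = (\<Sum>e\<in>edges G. of_bool (ends G e \<inter> S \<noteq> {}) + of_bool (ends G e \<subseteq> S))"
  proof (rule sum.cong)
    fix e assume "e \<in> edges G"
    then obtain a b where ab: "ends G e = {a, b}" using ends_cases by blast
    have "(\<Sum>v\<in>S. of_bool (v \<in> ends G e) + of_bool (ends G e = {v})) =
        card (S \<inter> {a, b}) + card (S \<inter> {v. a = b \<and> v = a})"
    proof -
      have "(\<Sum>v\<in>S. of_bool (v \<in> ends G e)) = card (S \<inter> {v. v \<in> ends G e})"
        "(\<Sum>v\<in>S. of_bool (ends G e = {v})) = card (S \<inter> {v. ends G e = {v}})"
        using finS by simp_all
      moreover have "{v. v \<in> ends G e} = {a, b}" "{v. ends G e = {v}} = {v. a = b \<and> v = a}"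
        using ab by auto
      ultimately show ?thesis by (simp only: sum.distrib)
    qed
    also have "\<dots> = of_bool (ends G e \<inter> S \<noteq> {}) + of_bool (ends G e \<subseteq> S)"
      using ab by (cases "a \<in> S"; cases "b \<in> S"; cases "a = b") (auto simp: Int_insert_right)
    finally show "(\<Sum>v\<in>S. of_bool (v \<in> ends G e) + of_bool (ends G e = {v})) =
        of_bool (ends G e \<inter> S \<noteq> {}) + (of_bool (ends G e \<subseteq> S) :: nat)" by simp
  qed simp
  also have "\<dots> = card (incident_edges G S) + card (induced_edges G S)"
    by (simp add: sum.distrib incident_edges_def induced_edges_def Int_def)
  finally show ?thesis by simp
qed

lemma card_incident_plus_induced_complement:
  assumes "S \<subseteq> verts G"
  shows "card (incident_edges G S) + card (induced_edges G (verts G - S)) = card (edges G)"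
proof -
  have "card (edges G - incident_edges G S) = card (edges G) - card (incident_edges G S)"
    using incident_edges_subset by (intro card_Diff_subset finite_esubset) auto
  moreover have "card (incident_edges G S) \<le> card (edges G)"
    using incident_edges_subset by (intro card_mono) auto
  ultimately show ?thesis by (simp add: edges_minus_incident)
qed

lemma card_edges: "2 * card (edges G) = 3 * card (verts G)"
proof -
  have "incident_edges G (verts G) = edges G" "induced_edges G (verts G) = edges G"
    using ends_subset ends_cases by (auto simp: incident_edges_def induced_edges_def) blast
  then show ?thesis using card_incident_plus_induced[of "verts G"] by simp
qed

lemma component_subset_induced:
  assumes "v \<in> S"
  shows "component G (induced_edges G S) v \<subseteq> S"
proof
  fix w assume "w \<in> component G (induced_edges G S) v"
  then have "(v, w) \<in> conn G (induced_edges G S)" by (simp add: mem_component_iff)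
  then show "w \<in> S"
    by (rule conn_closed) (use assms in \<open>auto simp: induced_edges_def\<close>)
qed

lemma finite_components: "S \<subseteq> verts G \<Longrightarrow> finite (components G S)"
  by (simp add: components_def finite_vsubset)

lemma ncomp_induced:
  assumes "S \<subseteq> verts G"
  shows "ncomp G (induced_edges G S) = card (verts G - S) + card (components G S)"
proof -
  let ?c = "component G (induced_edges G S)"
  have single: "?c v = {v}" if "v \<notin> S" for v
  proof -
    have "w = v" if "(v, w) \<in> conn G (induced_edges G S)" for w
    proof -
      have "w \<in> {v}" using that
        by (rule conn_closed) (use \<open>v \<notin> S\<close> in \<open>auto simp: induced_edges_def\<close>)
      then show ?thesis by simp
    qed
    then show ?thesis by (auto simp: mem_component_iff)
  qed
  have "?c ` verts G = ?c ` (verts G - S) \<union> ?c ` S" using assms by blast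
  moreover have "?c ` (verts G - S) \<inter> ?c ` S = {}"
    using single component_subset_induced[of _ S] by fastforce
  moreover have "card (?c ` (verts G - S)) = card (verts G - S)"
    using single by (intro card_image) (auto simp: inj_on_def)
  ultimately show ?thesis
    unfolding ncomp_def components_def using finite_vsubset[OF assms]
    by (simp add: card_Un_disjoint)
qed

lemma ncomp_edges: "ncomp G (edges G) = 1"
proof -
  have V: "verts G \<noteq> {}" and c: "\<And>u v. u \<in> verts G \<Longrightarrow> v \<in> verts G \<Longrightarrow> (u, v) \<in> conn G (edges G)"
    using connected by (auto simp: connected_graph_def conn_def adj_def)
  have "component G (edges G) v = verts G" if "v \<in> verts G" for v
    using component_subset[of "edges G" v] c that by (auto simp: mem_component_iff)
  then have "component G (edges G) ` verts G = {verts G}" using V by auto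
  then show ?thesis by (simp add: ncomp_def)
qed

section \<open>Monotonicity and submodularity of the bond rank\<close>

lemma bond_rank_mono:
  assumes "X \<subseteq> Y" "Y \<subseteq> edges G"
  shows "bond_rank G X \<le> bond_rank G Y"
proof -
  have *: "card (edges G - Z) + card Z = card (edges G)" if "Z \<subseteq> edges G" for Z
    using that finite_esubset card_mono[OF finite_edges that] by (simp add: card_Diff_subset)
  \<comment> \<open>Complementation turns the claim into monotonicity of the nullity.\<close>
  have "ncomp G (edges G - Y) + card (edges G - Y) \<le> ncomp G (edges G - X) + card (edges G - X)"
    using assms by (intro ncomp_plus_card_mono) auto
  then show ?thesis using *[of X] *[of Y] assms subset_trans[OF assms] by (simp add: bond_rank_eq)
qed

text \<open>Complements exchange union and intersection, cardinality is modular, and the component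
  count enters with a minus sign, so supermodularity of \<open>ncomp\<close> is what is
  needed.\<close>

lemma bond_rank_submodular:
  assumes "X \<subseteq> edges G" "Y \<subseteq> edges G"
  shows "bond_rank G (X \<union> Y) + bond_rank G (X \<inter> Y) \<le> bond_rank G X + bond_rank G Y"
proof -
  have "card X + card Y = card (X \<union> Y) + card (X \<inter> Y)"
    using assms finite_esubset by (intro card_Un_Int) auto
  moreover have "edges G - (X \<union> Y) = (edges G - X) \<inter> (edges G - Y)"
    "edges G - (X \<inter> Y) = (edges G - X) \<union> (edges G - Y)" by auto
  moreover have "X \<inter> Y \<subseteq> edges G" using assms by auto
  ultimately show ?thesis
    using ncomp_supermodular[of "edges G - X" "edges G - Y"] assms by (simp add: bond_rank_eq)
qed

text \<open>The function \<open>f\<close> of the overview. Subtracting 1 turns the strict inequality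
  between \<open>card A\<close> and the bond rank into \<open>card A \<le> bound A\<close>. The
  empty set gets the value -1, hence the type \<open>int\<close>.\<close>

definition bound :: "'v set \<Rightarrow> int" where
  "bound A = bond_rank G (incident_edges G A) - 1"

text \<open>Without \<open>incident_edges G A\<close> the vertices of \<open>A\<close> are isolated
  and contribute \<open>card A\<close> components; the 1 cancels against the single component of
  \<open>G\<close>.\<close>

lemma bound_eq:
  assumes "A \<subseteq> verts G"
  shows "bound A = int (card (incident_edges G A)) - int (card A) - int (card (components G (verts G - A)))"
  using assms
  by (simp add: bound_def bond_rank_eq incident_edges_subset edges_minus_incident ncomp_induced
      ncomp_edges double_diff)

lemma bound_mono:
  assumes "A \<subseteq> B"
  shows "bound A \<le> bound B"
  unfolding bound_def using assms
  by (intro diff_right_mono bond_rank_mono incident_edges_subset) (auto simp: incident_edges_def)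

text \<open>\<open>incident_edges\<close> commutes with unions, but an edge between
  \<open>A - B\<close> and \<open>B - A\<close> lies in both edge sets without meeting
  \<open>A \<inter> B\<close>; monotonicity of the bond rank absorbs this.\<close>

lemma bound_submodular: "bound (A \<union> B) + bound (A \<inter> B) \<le> bound A + bound B"
proof -
  have "incident_edges G (A \<union> B) = incident_edges G A \<union> incident_edges G B"
    by (auto simp: incident_edges_def)
  moreover have "bond_rank G (incident_edges G (A \<inter> B))
      \<le> bond_rank G (incident_edges G A \<inter> incident_edges G B)"
    using incident_edges_subset[of A] by (intro bond_rank_mono) (auto simp: incident_edges_def)
  ultimately show ?thesis
    using bond_rank_submodular[of "incident_edges G A" "incident_edges G B"] incident_edges_subset
    by (simp add: bound_def)
qed

text \<open>Monotonicity reduces to \<open>verts G\<close>, where the value is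
  \<open>card (edges G) - card (verts G)\<close>, half of \<open>card (verts G)\<close> by
  trivalence.\<close>

lemma bound_le_half:
  assumes "A \<subseteq> verts G"
  shows "2 * bound A \<le> int (card (verts G))"
proof -
  have "incident_edges G (verts G) = edges G"
    using ends_subset ends_cases by (auto simp: incident_edges_def) blast
  then have "2 * bound (verts G) = int (card (verts G))"
    using card_edges by (simp add: bound_eq components_def)
  then show ?thesis using bound_mono[OF assms] by simp
qed

lemma gcm_indep_bound:
  "gcm_indep I \<longleftrightarrow> I \<subseteq> verts G \<and> (\<forall>A\<subseteq>I. A \<noteq> {} \<longrightarrow> int (card A) \<le> bound A)"
  unfolding gcm_indep_def gcm_small_def bound_def by (auto simp: not_le)

lemma gcm_indep_subset: "gcm_indep I \<Longrightarrow> A \<subseteq> I \<Longrightarrow> gcm_indep A"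
  unfolding gcm_indep_bound by blast

lemma card_gcm_indep:
  assumes "gcm_indep I"
  shows "2 * card I \<le> card (verts G)"
  using assms bound_le_half[of I] unfolding gcm_indep_bound by (cases "I = {}") auto

section \<open>Edge cuts and components\<close>

definition boundary :: "'v set \<Rightarrow> 'e set" where
  "boundary C = incident_edges G C - induced_edges G C"

lemma card_boundary:
  assumes "S \<subseteq> verts G"
  shows "2 * card (incident_edges G S) = 3 * card S + card (boundary S)"
proof -
  have "induced_edges G S \<subseteq> incident_edges G S"
    using ends_cases by (auto simp: induced_edges_def incident_edges_def) blast
  then have "card (boundary S) + card (induced_edges G S) = card (incident_edges G S)"
    unfolding boundary_def using card_mono[of "incident_edges G S" "induced_edges G S"]
    by (simp add: card_Diff_subset finite_esubset[OF incident_edges_subset] finite_esubset[OF induced_edges_subset])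
  then show ?thesis using card_incident_plus_induced[OF assms] by simp
qed

lemma boundary_component:
  assumes "C \<in> components G S"
  shows "boundary C \<inter> induced_edges G S = {}"
proof -
  obtain v where v: "v \<in> S" "C = component G (induced_edges G S) v"
    using assms by (auto simp: components_def)
  have False if e: "e \<in> boundary C" "e \<in> induced_edges G S" for e
  proof -
    have "e \<in> edges G" using e(2) by (simp add: induced_edges_def)
    then obtain c d where "ends G e = {c, d}" using ends_cases by blast
    moreover have "ends G e \<inter> C \<noteq> {}" "\<not> ends G e \<subseteq> C"
      using e(1) by (auto simp: boundary_def incident_edges_def induced_edges_def)
    ultimately obtain a b where ab: "ends G e = {a, b}" "a \<in> C" "b \<notin> C"
      by (auto simp: insert_commute)
    then show False using v conn_edge[OF e(2) ab(1)] conn_trans[of v a _ _ b]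
      by (auto simp: mem_component_iff)
  qed
  then show ?thesis by blast
qed

lemma components_disjoint:
  assumes "C \<in> components G S" "D \<in> components G S" "x \<in> C" "x \<in> D"
  shows "C = D"
  using assms component_eqI unfolding components_def by (metis imageE)

lemma component_of_subset: "C \<in> components G S \<Longrightarrow> C \<subseteq> S"
  using component_subset_induced[of _ S] by (auto simp: components_def)

lemma component_nonempty:
  assumes "C \<in> components G S"
  shows "C \<noteq> {}"
proof -
  obtain v where "C = component G (induced_edges G S) v"
    using assms by (auto simp: components_def)
  then have "v \<in> C" by simp
  then show ?thesis by blast
qed

lemma Union_components: "\<Union>(components G S) = S"
proof
  show "\<Union>(components G S) \<subseteq> S" using component_of_subset by blast
  show "S \<subseteq> \<Union>(components G S)"
  proof
    fix v assume "v \<in> S"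
    then have "component G (induced_edges G S) v \<in> components G S" by (simp add: components_def)
    then show "v \<in> \<Union>(components G S)" using component_self by (rule UnionI)
  qed
qed

text \<open>Once the cut is deleted, \<open>C\<close> is closed under the remaining edges, so a cut
  with fewer than two edges contradicts 2-edge-connectivity.\<close>

lemma two_le_boundary:
  assumes "edge_connected 2 G" "C \<subseteq> verts G" "C \<noteq> {}" "C \<noteq> verts G"
  shows "2 \<le> card (boundary C)"
proof (rule ccontr)
  assume "\<not> 2 \<le> card (boundary C)"
  moreover have "boundary C \<subseteq> edges G" by (auto simp: boundary_def incident_edges_def)
  ultimately have "connected_graph (delete_edges G (boundary C))"
    using assms(1) by (auto simp: edge_connected_def)
  moreover obtain u v where uv: "u \<in> C" "v \<in> verts G" "v \<notin> C" using assms by blast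
  ultimately have "(u, v) \<in> conn G (edges G - boundary C)"
    using assms(2) by (auto simp: connected_graph_def delete_edges_def adj_def conn_def)
  then have "v \<in> C" using uv(1)
    by (rule conn_closed) (auto simp: boundary_def incident_edges_def induced_edges_def)
  with uv show False by simp
qed

text \<open>The cuts of the components of \<open>verts G - W\<close> are disjoint parts of
  \<open>boundary W\<close> with at least two edges each. So twice the number of components is at
  most \<open>card (boundary W)\<close>, and \<open>card_boundary\<close> converts this.\<close>

lemma half_le_bound:
  assumes "edge_connected 2 G" "W \<subseteq> verts G" "W \<noteq> {}"
  shows "int (card W) \<le> 2 * bound W"
proof -
  let ?\<C> = "components G (verts G - W)"
  have sub: "C \<subseteq> verts G - W" and ne: "C \<noteq> {}" if "C \<in> ?\<C>" for C
    using component_of_subset[OF that] component_nonempty[OF that] .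
  have B: "boundary C \<subseteq> boundary W" if "C \<in> ?\<C>" for C
  proof
    fix e assume e: "e \<in> boundary C"
    then have "e \<in> edges G" "ends G e \<inter> C \<noteq> {}" "\<not> ends G e \<subseteq> verts G - W"
      using boundary_component[OF that] by (auto simp: boundary_def incident_edges_def induced_edges_def)
    then show "e \<in> boundary W"
      using sub[OF that] ends_subset[of e]
      unfolding boundary_def incident_edges_def induced_edges_def by blast
  qed
  have disj: "boundary C \<inter> boundary D = {}" if CD: "C \<in> ?\<C>" "D \<in> ?\<C>" "C \<noteq> D" for C D
  proof -
    have False if e: "e \<in> boundary C" "e \<in> boundary D" for e
    proof -
      obtain x y where xy: "x \<in> ends G e" "x \<in> C" "y \<in> ends G e" "y \<in> D" and eE: "e \<in> edges G"
        using e by (auto simp: boundary_def incident_edges_def)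
      have "x \<noteq> y" using components_disjoint[OF CD(1,2) xy(2)] xy(4) CD(3) by blast
      obtain a b where "ends G e = {a, b}" using ends_cases[OF eE] .
      then have "ends G e = {x, y}" using xy \<open>x \<noteq> y\<close> by auto
      moreover have "ends G e \<inter> W \<noteq> {}"
        using B[OF CD(1)] e by (auto simp: boundary_def incident_edges_def)
      ultimately show False using sub[OF CD(1)] sub[OF CD(2)] xy(2,4) by auto
    qed
    then show ?thesis by blast
  qed
  have fin: "finite ?\<C>" by (rule finite_components) auto
  have finW: "finite (boundary W)"
    unfolding boundary_def using finite_esubset[OF incident_edges_subset] by blast
  have "2 * card ?\<C> = (\<Sum>C\<in>?\<C>. 2)" by simp
  also have "\<dots> \<le> (\<Sum>C\<in>?\<C>. card (boundary C))"
  proof (rule sum_mono)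
    fix C assume "C \<in> ?\<C>"
    then show "2 \<le> card (boundary C)"
      using sub ne assms by (intro two_le_boundary) blast+
  qed
  also have "\<dots> = card (\<Union>C\<in>?\<C>. boundary C)"
    using fin disj finite_subset[OF B finW] by (subst card_UN_disjoint) auto
  also have "\<dots> \<le> card (boundary W)" using B finW by (intro card_mono) auto
  finally show ?thesis
    using card_boundary[OF assms(2)] bound_eq[OF assms(2)] by simp
qed

text \<open>
  Call \<open>W\<close> tight if \<open>f(W) \<le> |W \<inter> I|\<close>. Every vertex outside a maximal independent \<open>I\<close> lies in a tight
  set, tight sets that meet can be merged, and \<open>|W| \<le> 2 f(W)\<close> gives \<open>|W - I| \<le> |W \<inter> I|\<close> for tight \<open>W\<close>.
\<close>

lemma maximal_gcm_indep:
  assumes ec: "edge_connected 2 G" and I: "gcm_indep I"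
    and max: "\<And>v. v \<in> verts G - I \<Longrightarrow> \<not> gcm_indep (insert v I)"
  shows "2 * card I = card (verts G)"
proof -
  define tight where "tight W \<longleftrightarrow> W \<subseteq> verts G \<and> W \<noteq> {} \<and> bound W \<le> int (card (W \<inter> I))" for W
  define \<M> where "\<M> = {W. tight W \<and> (\<forall>U. tight U \<longrightarrow> W \<subseteq> U \<longrightarrow> U = W)}"
  have IV: "I \<subseteq> verts G" and le: "\<And>A. A \<subseteq> I \<Longrightarrow> A \<noteq> {} \<Longrightarrow> int (card A) \<le> bound A"
    using I by (auto simp: gcm_indep_bound)
  \<comment> \<open>If \<open>W\<close> misses \<open>I\<close>, only nonnegativity of the bound is
    needed, and \<open>half_le_bound\<close> gives it.\<close>
  have le': "int (card (W \<inter> I)) \<le> bound W" if "W \<subseteq> verts G" "W \<noteq> {}" for W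
  proof (cases "W \<inter> I = {}")
    case True
    then show ?thesis using half_le_bound[OF ec that] by simp
  next
    case False
    then show ?thesis using le[of "W \<inter> I"] bound_mono[of "W \<inter> I" W] by simp
  qed
  \<comment> \<open>\<open>card (W \<inter> I)\<close> is modular in \<open>W\<close> and
    \<open>bound\<close> is submodular; \<open>le'\<close> on the non-empty intersection then forces
    tightness of the union.\<close>
  have tight_Un: "tight (W \<union> U)" if "tight W" "tight U" "W \<inter> U \<noteq> {}" for W U
  proof -
    have "finite (W \<inter> I)" "finite (U \<inter> I)" using IV finite_vsubset by auto
    then have "card (W \<inter> I) + card (U \<inter> I) = card ((W \<union> U) \<inter> I) + card ((W \<inter> U) \<inter> I)"
      using card_Un_Int[of "W \<inter> I" "U \<inter> I"] by (simp add: Int_Un_distrib Int_ac)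
    moreover have "int (card ((W \<inter> U) \<inter> I)) \<le> bound (W \<inter> U)"
      using that by (intro le') (auto simp: tight_def)
    ultimately show ?thesis using that bound_submodular[of W U] by (auto simp: tight_def)
  qed
  \<comment> \<open>A violating subset of \<open>insert v I\<close> must contain \<open>v\<close>.
    Intersecting with \<open>I\<close> loses just that element, so strict violation becomes
    tightness.\<close>
  have cover: "\<exists>W. tight W \<and> v \<in> W" if v: "v \<in> verts G - I" for v
  proof -
    obtain A where A: "A \<subseteq> insert v I" "A \<noteq> {}" "bound A < int (card A)"
      using max[OF v] v IV unfolding gcm_indep_bound by (auto simp: not_le)
    then have "v \<in> A" using le[of A] by auto
    then have "A = insert v (A \<inter> I)" using A by auto
    then have "card A = Suc (card (A \<inter> I))"
      using v IV finite_vsubset by (metis DiffD2 Int_iff card_insert_disjoint finite_Int)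
    then have "tight A" using A v IV by (auto simp: tight_def)
    then show ?thesis using \<open>v \<in> A\<close> by blast
  qed
  have fin: "finite {W. tight W}"
    by (rule finite_subset[of _ "Pow (verts G)"]) (auto simp: tight_def)
  have max_tight: "\<exists>U\<in>\<M>. W \<subseteq> U" if "tight W" for W
    using finite_has_maximal2[OF fin, of W] that by (auto simp: \<M>_def)
  have disj: "W \<inter> U = {}" if "W \<in> \<M>" "U \<in> \<M>" "W \<noteq> U" for W U
    using tight_Un[of W U] that by (auto simp: \<M>_def)
  have fin\<M>: "finite \<M>" using fin by (auto simp: \<M>_def intro: finite_subset)
  have finW: "finite W" if "W \<in> \<M>" for W using that finite_vsubset by (auto simp: \<M>_def tight_def)
  \<comment> \<open>Maximal tight sets are disjoint and cover \<open>verts G - I\<close>, so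
    comparing \<open>W - I\<close> with \<open>W \<inter> I\<close> for each of them compares
    \<open>verts G - I\<close> with \<open>I\<close>.\<close>
  have "card (verts G - I) \<le> card (\<Union>W\<in>\<M>. W - I)"
    using cover max_tight fin\<M> finW by (intro card_mono) (auto, blast)
  also have "\<dots> \<le> (\<Sum>W\<in>\<M>. card (W - I))" by (rule card_UN_le[OF fin\<M>])
  also have "\<dots> \<le> (\<Sum>W\<in>\<M>. card (W \<inter> I))"
  proof (rule sum_mono)
    fix W assume W: "W \<in> \<M>"
    have "card W = card (W - I) + card (W \<inter> I)"
      using card_Int_Diff[OF finW[OF W], of I] by simp
    then show "card (W - I) \<le> card (W \<inter> I)"
      using half_le_bound[OF ec, of W] W by (auto simp: \<M>_def tight_def)
  qed
  also have "\<dots> = card (\<Union>W\<in>\<M>. W \<inter> I)"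
    using fin\<M> finW disj by (subst card_UN_disjoint) auto
  also have "\<dots> \<le> card I" using finite_vsubset[OF IV] by (intro card_mono) auto
  finally show ?thesis
    using card_gcm_indep[OF I] card_Diff_subset[OF finite_vsubset[OF IV] IV] card_mono[OF finite_verts IV]
    by simp
qed

lemma gcm_basis_extension:
  assumes ec: "edge_connected 2 G" and I: "gcm_indep I"
  obtains B where "I \<subseteq> B" "gcm_indep B" "2 * card B = card (verts G)"
proof -
  have "finite {B. gcm_indep B}"
    by (rule finite_subset[of _ "Pow (verts G)"]) (auto simp: gcm_indep_def)
  then obtain B where B: "gcm_indep B" "I \<subseteq> B" "\<And>B'. gcm_indep B' \<Longrightarrow> B \<subseteq> B' \<Longrightarrow> B = B'"
    using finite_has_maximal2[of "{B. gcm_indep B}" I] I by auto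
  have "2 * card B = card (verts G)"
    using B(3) by (intro maximal_gcm_indep[OF ec B(1)]) blast
  with B that show ?thesis by blast
qed

section \<open>Self-duality\<close>

lemma boundaryE:
  assumes "e \<in> boundary K"
  obtains x y where "e \<in> edges G" "ends G e = {x, y}" "x \<in> K" "y \<in> verts G - K"
proof -
  have e: "e \<in> edges G" "ends G e \<inter> K \<noteq> {}" "\<not> ends G e \<subseteq> K"
    using assms by (auto simp: boundary_def incident_edges_def induced_edges_def)
  obtain a b where "ends G e = {a, b}" "a \<in> verts G" "b \<in> verts G" using ends_cases[OF e(1)] .
  then show ?thesis using e that[of a b] that[of b a] by (auto simp: insert_commute)
qed

lemma boundaryI: "e \<in> edges G \<Longrightarrow> ends G e = {x, y} \<Longrightarrow> x \<in> K \<Longrightarrow> y \<notin> K \<Longrightarrow> e \<in> boundary K"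
  by (simp add: boundary_def incident_edges_def induced_edges_def)

text \<open>Connectivity is expressed within \<open>K\<close> alone, so to carry a component over to
  another \<open>T\<close> only containment and the boundary need checking.\<close>

lemma components_iff:
  "K \<in> components G T \<longleftrightarrow> K \<noteq> {} \<and> K \<subseteq> T \<and> boundary K \<inter> induced_edges G T = {} \<and>
     (\<forall>u\<in>K. \<forall>v\<in>K. (u, v) \<in> conn G (induced_edges G K))" (is "_ \<longleftrightarrow> ?R")
proof
  assume K: "K \<in> components G T"
  then obtain v where v: "v \<in> T" "K = component G (induced_edges G T) v"
    by (auto simp: components_def)
  have "(v, w) \<in> conn G (induced_edges G K)" if "w \<in> K" for w
  proof -
    have "(v, w) \<in> conn G (induced_edges G T)" using that v by (simp add: mem_component_iff)
    \<comment> \<open>Tracking both sets at once ensures that the walk stays in \<open>K\<close> and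
      thus uses only edges induced by \<open>K\<close>.\<close>
    then have "w \<in> K \<inter> component G (induced_edges G K) v"
    proof (rule conn_closed)
      show "v \<in> K \<inter> component G (induced_edges G K) v" using v(2) by simp
    next
      fix e x y
      assume e: "e \<in> induced_edges G T" "ends G e = {x, y}"
        and x: "x \<in> K \<inter> component G (induced_edges G K) v"
      have eE: "e \<in> edges G" using e(1) by (simp add: induced_edges_def)
      have y: "y \<in> K"
        using boundaryI[OF eE e(2), of K] boundary_component[OF K] x e(1) by blast
      then have "e \<in> induced_edges G K" using eE e(2) x by (simp add: induced_edges_def)
      then show "y \<in> K \<inter> component G (induced_edges G K) v"
        using conn_edge[OF _ e(2)] conn_trans[of v x] x y by (auto simp: mem_component_iff)
    qed
    then show ?thesis by (simp add: mem_component_iff)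
  qed
  then have "\<forall>u\<in>K. \<forall>w\<in>K. (u, w) \<in> conn G (induced_edges G K)"
    by (meson conn_sym conn_trans)
  then show ?R
    using boundary_component[OF K] component_of_subset[OF K] component_nonempty[OF K] by blast
next
  assume K: ?R
  then obtain v where v: "v \<in> K" "v \<in> T" by blast
  have "induced_edges G K \<subseteq> induced_edges G T" using K by (auto simp: induced_edges_def)
  then have "K \<subseteq> component G (induced_edges G T) v"
    using K v conn_mono unfolding mem_component_iff subset_iff by meson
  moreover have "component G (induced_edges G T) v \<subseteq> K"
  proof
    fix w assume "w \<in> component G (induced_edges G T) v"
    then have "(v, w) \<in> conn G (induced_edges G T)" by (simp add: mem_component_iff)
    then show "w \<in> K"
    proof (rule conn_closed[OF _ v(1)])
      fix e x y
      assume e: "e \<in> induced_edges G T" "ends G e = {x, y}" "x \<in> K"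
      then have "e \<notin> boundary K" "e \<in> edges G" using K by (auto simp: induced_edges_def)
      then show "y \<in> K" using boundaryI e(2,3) by blast
    qed
  qed
  ultimately show "K \<in> components G T" using v by (auto simp: components_def)
qed

lemma twice_card_induced_le:
  assumes "S \<subseteq> verts G"
  shows "2 * card (induced_edges G S) \<le> 3 * card S"
  using card_boundary[OF assms] card_incident_plus_induced[OF assms] by simp

text \<open>
  Let \<open>A\<close> be a maximal violating subset of \<open>J = V - I\<close>, and let \<open>m = c(V - A)\<close>. By maximality each
  component \<open>C\<close> of \<open>V - A\<close> meets \<open>I\<close>. Every component of \<open>J\<close> that lies in \<open>C\<close> and misses \<open>A\<close> is also a
  component of \<open>V - I \<inter> C\<close>, so independence of the sets \<open>I \<inter> C\<close>, summed over \<open>C\<close>, gives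
  \<open>2|I| + m + N \<le> |\<delta>(I)|\<close>, where \<open>N\<close> counts the components of \<open>J\<close> that miss \<open>A\<close>. As \<open>J\<close> induces a
  forest with \<open>|\<delta>(I)| - 2|I|\<close> components, at least \<open>m\<close> of them meet \<open>A\<close>; hence
  \<open>m \<le> c(A) \<le> |\<delta>(A)| - 2|A|\<close>, against the choice of \<open>A\<close>.
\<close>

lemma gcm_indep_complement:
  assumes I: "gcm_indep I" and half: "2 * card I = card (verts G)"
  shows "gcm_indep (verts G - I)"
proof (rule ccontr)
  define J where "J = verts G - I"
  have IV: "I \<subseteq> verts G" and indep: "\<And>A. A \<subseteq> I \<Longrightarrow> A \<noteq> {} \<Longrightarrow> int (card A) \<le> bound A"
    using I by (auto simp: gcm_indep_bound)
  have JV: "J \<subseteq> verts G" and IJ: "verts G - J = I" using IV by (auto simp: J_def)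
  define bad where "bad = {A. A \<subseteq> J \<and> A \<noteq> {} \<and> bound A < int (card A)}"
  assume "\<not> gcm_indep (verts G - I)"
  then obtain A0 where "A0 \<subseteq> J" "A0 \<noteq> {}" "bound A0 < int (card A0)"
    unfolding gcm_indep_bound J_def by (meson Diff_subset not_le)
  then have "bad \<noteq> {}" unfolding bad_def by blast
  moreover have "finite bad"
    by (rule finite_subset[of _ "Pow J"]) (auto simp: bad_def finite_vsubset[OF JV])
  ultimately obtain A where "A \<in> bad" and maxA: "\<And>B. B \<in> bad \<Longrightarrow> A \<subseteq> B \<Longrightarrow> A = B"
    using finite_has_maximal[of bad] by blast
  then have A: "A \<subseteq> J" "A \<noteq> {}" "bound A < int (card A)" by (auto simp: bad_def)
  have AV: "A \<subseteq> verts G" and AI: "A \<inter> I = {}" using A(1) by (auto simp: J_def)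
  note fin = finite_vsubset finite_esubset[OF incident_edges_subset]
    finite_esubset[OF induced_edges_subset] finite_components
  let ?\<C> = "components G (verts G - A)"
  have sub: "C \<subseteq> verts G - A" if "C \<in> ?\<C>" for C using component_of_subset[OF that] .
  have few: "card (incident_edges G A) < 2 * card A + card ?\<C>"
    using A(3) bound_eq[OF AV] by simp

  \<comment> \<open>Otherwise \<open>A \<union> C\<close> would be a larger violating set: edges
    leaving \<open>C\<close> end in \<open>A\<close>, so only the edges inside \<open>C\<close>, at
    most \<open>3 * card C / 2\<close>, are new, and at most one component is lost.\<close>
  have meets: "I \<inter> C \<noteq> {}" if C: "C \<in> ?\<C>" for C
  proof
    assume IC: "I \<inter> C = {}"
    have CV: "C \<subseteq> verts G" "A \<inter> C = {}" and CJ: "C \<subseteq> J"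
      using sub[OF C] IC by (auto simp: J_def)
    have "incident_edges G (A \<union> C) \<subseteq> incident_edges G A \<union> induced_edges G C"
    proof
      fix e assume e: "e \<in> incident_edges G (A \<union> C)"
      show "e \<in> incident_edges G A \<union> induced_edges G C"
        using e boundary_component[OF C] edges_minus_incident[of A]
        unfolding boundary_def by (auto simp: incident_edges_def)
    qed
    then have "card (incident_edges G (A \<union> C)) \<le> card (incident_edges G A \<union> induced_edges G C)"
      using fin by (intro card_mono) auto
    also have "\<dots> \<le> card (incident_edges G A) + card (induced_edges G C)" by (rule card_Un_le)
    finally have 1: "card (incident_edges G (A \<union> C)) \<le> card (incident_edges G A) + card (induced_edges G C)" .
    have 2: "card (A \<union> C) = card A + card C"
      using fin(1) AV CV by (intro card_Un_disjoint) auto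
    have "?\<C> - {C} \<subseteq> components G (verts G - (A \<union> C))"
    proof
      fix D assume D: "D \<in> ?\<C> - {C}"
      have "D \<subseteq> verts G - (A \<union> C)"
        using components_disjoint[of D _ C] D C sub[of D] by blast
      moreover have "induced_edges G (verts G - (A \<union> C)) \<subseteq> induced_edges G (verts G - A)"
        by (auto simp: induced_edges_def)
      moreover have "D \<in> ?\<C>" using D by blast
      ultimately show "D \<in> components G (verts G - (A \<union> C))"
        unfolding components_iff by blast
    qed
    then have "card (?\<C> - {C}) \<le> card (components G (verts G - (A \<union> C)))"
      by (intro card_mono finite_components) auto
    then have 3: "card ?\<C> \<le> Suc (card (components G (verts G - (A \<union> C))))"
      using C by (simp add: card_Diff_singleton)
    have "C \<noteq> {}" by (rule component_nonempty[OF C])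
    then have "card C > 0" using fin(1)[OF CV(1)] by (simp add: card_gt_0_iff)
    then have "bound (A \<union> C) < int (card (A \<union> C))"
      using 1 2 3 few twice_card_induced_le[OF CV(1)] bound_eq[of "A \<union> C"] AV CV(1) by simp
    then have "A \<union> C \<in> bad" using A CJ by (simp add: bad_def)
    then show False using maxA[of "A \<union> C"] CV \<open>C \<noteq> {}\<close> by blast
  qed

  define \<N> where "\<N> C = {K \<in> components G J. K \<inter> A = {} \<and> K \<subseteq> C}" for C
  have finN: "finite (\<N> C)" for C using finite_components[OF JV] by (simp add: \<N>_def)
  \<comment> \<open>The extra 1 counts the component of \<open>verts G - I \<inter> C\<close> that
    contains a point of \<open>A\<close>; members of \<open>\<N> C\<close> avoid \<open>A\<close>.
    Independence is applied to \<open>I \<inter> C\<close>, non-empty by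
    \<open>meets\<close>.\<close>
  have local_ineq: "2 * card (I \<inter> C) + (1 + card (\<N> C)) \<le> card (incident_edges G (I \<inter> C))"
    if C: "C \<in> ?\<C>" for C
  proof -
    let ?T = "verts G - I \<inter> C"
    obtain a where a: "a \<in> A" using A by blast
    then have aT: "a \<in> ?T" using AV AI by blast
    let ?K = "component G (induced_edges G ?T) a"
    have "\<N> C \<subseteq> components G ?T"
    proof
      fix K assume K: "K \<in> \<N> C"
      then have KJ: "K \<in> components G J" and KA: "K \<inter> A = {}" "K \<subseteq> C" by (auto simp: \<N>_def)
      have "K \<subseteq> ?T" using component_of_subset[OF KJ] by (auto simp: J_def)
      moreover have "boundary K \<inter> induced_edges G ?T = {}"
      proof -
        have False if e: "e \<in> boundary K" "e \<in> induced_edges G ?T" for e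
        proof -
          obtain x y where xy: "e \<in> edges G" "ends G e = {x, y}" "x \<in> K" "y \<in> verts G - K"
            using boundaryE[OF e(1)] .
          have x: "x \<in> J" "x \<in> C" using component_of_subset[OF KJ] KA xy by auto
          have "y \<notin> J"
            using boundary_component[OF KJ] e(1) xy x by (auto simp: induced_edges_def)
          then have y: "y \<in> I" using xy by (simp add: J_def)
          then have "e \<in> induced_edges G (verts G - A)"
            using xy x sub[OF C] AI by (auto simp: induced_edges_def)
          then have "y \<in> C"
            using boundaryI[OF xy(1,2) x(2)] boundary_component[OF C] by blast
          then show False using y e(2) xy(2) by (simp add: induced_edges_def)
        qed
        then show ?thesis by blast
      qed
      ultimately show "K \<in> components G ?T" using KJ unfolding components_iff by blast
    qed
    moreover have "?K \<in> components G ?T" using aT by (simp add: components_def)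
    moreover have "?K \<notin> \<N> C" using a component_self[of a G "induced_edges G ?T"] unfolding \<N>_def by blast
    ultimately have "card (insert ?K (\<N> C)) \<le> card (components G ?T)"
      by (intro card_mono finite_components) auto
    then have "1 + card (\<N> C) \<le> card (components G ?T)"
      using \<open>?K \<notin> \<N> C\<close> finN by simp
    moreover have "int (card (I \<inter> C)) \<le> bound (I \<inter> C)"
      using meets[OF C] by (intro indep) auto
    moreover have "I \<inter> C \<subseteq> verts G" using IV by blast
    ultimately show ?thesis using bound_eq[of "I \<inter> C"] by simp
  qed

  define N where "N = card {K \<in> components G J. K \<inter> A = {}}"
  have finC: "finite ?\<C>" by (rule finite_components) auto
  have disj: "(I \<inter> C) \<inter> (I \<inter> D) = {}" if "C \<in> ?\<C>" "D \<in> ?\<C>" "C \<noteq> D" for C D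
    using components_disjoint[OF that(1,2)] that(3) by blast
  \<comment> \<open>An edge meeting \<open>I\<close> in two components of \<open>verts G - A\<close>
    would join them inside that induced subgraph.\<close>
  have disj_inc: "incident_edges G (I \<inter> C) \<inter> incident_edges G (I \<inter> D) = {}"
    if CD: "C \<in> ?\<C>" "D \<in> ?\<C>" "C \<noteq> D" for C D
  proof -
    have False if e: "e \<in> incident_edges G (I \<inter> C)" "e \<in> incident_edges G (I \<inter> D)" for e
    proof -
      obtain x y where xy: "x \<in> ends G e" "x \<in> I \<inter> C" "y \<in> ends G e" "y \<in> I \<inter> D"
        and eE: "e \<in> edges G" using e by (auto simp: incident_edges_def)
      have y: "y \<notin> C" using disj[OF CD] xy by blast
      obtain a b where "ends G e = {a, b}" using ends_cases[OF eE] .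
      then have ends: "ends G e = {x, y}" using xy y by auto
      then have "e \<in> induced_edges G (verts G - A)"
        using eE xy sub[OF CD(1)] sub[OF CD(2)] by (auto simp: induced_edges_def)
      then show False
        using boundaryI[OF eE ends _ y] xy boundary_component[OF CD(1)] by blast
    qed
    then show ?thesis by blast
  qed
  have "N \<le> card (\<Union>C\<in>?\<C>. \<N> C)"
    unfolding N_def
  proof (rule card_mono)
    show "finite (\<Union>C\<in>?\<C>. \<N> C)" using finC finN by blast
    show "{K \<in> components G J. K \<inter> A = {}} \<subseteq> (\<Union>C\<in>?\<C>. \<N> C)"
    proof clarify
      fix K assume K: "K \<in> components G J" "K \<inter> A = {}"
      then obtain v where v: "v \<in> K" and conn: "\<And>w. w \<in> K \<Longrightarrow> (v, w) \<in> conn G (induced_edges G K)"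
        unfolding components_iff by blast
      have KV: "K \<subseteq> verts G - A" using component_of_subset[OF K(1)] K(2) JV by blast
      then have "induced_edges G K \<subseteq> induced_edges G (verts G - A)" by (auto simp: induced_edges_def)
      then have "K \<subseteq> component G (induced_edges G (verts G - A)) v"
        using conn conn_mono unfolding mem_component_iff subset_iff by meson
      moreover have "component G (induced_edges G (verts G - A)) v \<in> ?\<C>"
        using v KV by (auto simp: components_def)
      ultimately show "K \<in> (\<Union>C\<in>?\<C>. \<N> C)" using K by (auto simp: \<N>_def)
    qed
  qed
  also have "\<dots> \<le> (\<Sum>C\<in>?\<C>. card (\<N> C))" by (rule card_UN_le[OF finC])
  finally have N_le: "N \<le> (\<Sum>C\<in>?\<C>. card (\<N> C))" .
  have "I = (\<Union>C\<in>?\<C>. I \<inter> C)" using Union_components[of "verts G - A"] IV AI by blast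
  then have card_I: "card I = (\<Sum>C\<in>?\<C>. card (I \<inter> C))"
    using card_UN_disjoint[of ?\<C> "\<lambda>C. I \<inter> C"] finC disj fin(1)[OF IV] by simp
  have "(\<Sum>C\<in>?\<C>. card (incident_edges G (I \<inter> C))) = card (\<Union>C\<in>?\<C>. incident_edges G (I \<inter> C))"
    using finC disj_inc fin by (subst card_UN_disjoint) auto
  also have "\<dots> \<le> card (incident_edges G I)"
    using fin by (intro card_mono) (auto simp: incident_edges_def)
  finally have "(\<Sum>C\<in>?\<C>. card (incident_edges G (I \<inter> C))) \<le> card (incident_edges G I)" .
  moreover have "(\<Sum>C\<in>?\<C>. 2 * card (I \<inter> C) + (1 + card (\<N> C))) \<le>
      (\<Sum>C\<in>?\<C>. card (incident_edges G (I \<inter> C)))"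
    by (rule sum_mono[OF local_ineq])
  ultimately have total: "2 * card I + card ?\<C> + N \<le> card (incident_edges G I)"
    using N_le card_I unfolding sum.distrib sum_distrib_left[symmetric] by simp

  have cardJ: "card J = card I"
    using half card_Diff_subset[OF fin(1)[OF IV] IV] by (simp add: J_def)
  have E: "card (edges G) = 3 * card I" using card_edges half by simp
  have indJ: "card (incident_edges G I) + card (induced_edges G J) = 3 * card I"
    using card_incident_plus_induced_complement[OF IV] E by (simp add: J_def)
  have nJ: "ncomp G (induced_edges G J) = card I + card (components G J)"
    using ncomp_induced[OF JV] IJ by simp
  have "card (verts G) \<le> ncomp G (induced_edges G J) + card (induced_edges G J)"
    using ncomp_plus_card_mono[of "{}" "induced_edges G J"] induced_edges_subset ncomp_empty by simp
  \<comment> \<open>Every graph has at least as many components as vertices minus edges. The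
    converse \<open>cJ_le\<close> is independence of \<open>I\<close> itself; equality means that
    \<open>J\<close> induces a forest.\<close>
  then have cJ_ge: "card (incident_edges G I) \<le> card (components G J) + 2 * card I"
    using nJ indJ half by simp
  have cJ_le: "card (components G J) + 2 * card I \<le> card (incident_edges G I)"
  proof -
    have "card (verts G) > 0" using A(2) AV by (auto simp: card_gt_0_iff)
    then have "I \<noteq> {}" using half by auto
    then show ?thesis using indep[of I] bound_eq[OF IV] by (simp add: J_def)
  qed

  define M where "M = card {K \<in> components G J. K \<inter> A \<noteq> {}}"
  have "card (components G J) =
      card ({K \<in> components G J. K \<inter> A = {}} \<union> {K \<in> components G J. K \<inter> A \<noteq> {}})"
    by (rule arg_cong[where f = card]) blast
  also have "\<dots> \<le> N + M" unfolding N_def M_def by (rule card_Un_le)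
  finally have "card (components G J) \<le> N + M" .
  then have "card ?\<C> \<le> M" using total cJ_ge cJ_le by simp
  \<comment> \<open>Each component of \<open>A\<close> is sent to the component of \<open>J\<close>
    containing it, and all those meeting \<open>A\<close> are hit. The union is over equal sets and
    avoids choosing a representative.\<close>
  also have "M \<le> card ((\<lambda>K. \<Union>x\<in>K. component G (induced_edges G J) x) ` components G A)"
    unfolding M_def
  proof (intro card_mono finite_imageI finite_components AV subsetI)
    fix K assume "K \<in> {K \<in> components G J. K \<inter> A \<noteq> {}}"
    then obtain a where a: "a \<in> A" "a \<in> K" and K: "K \<in> components G J" by blast
    have Ka: "K = component G (induced_edges G J) a"
    proof -
      obtain v where "K = component G (induced_edges G J) v" using K by (auto simp: components_def)
      then show ?thesis using component_eqI a by metis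
    qed
    have m: "induced_edges G A \<subseteq> induced_edges G J" using A(1) by (auto simp: induced_edges_def)
    have "component G (induced_edges G J) x = K" if "x \<in> component G (induced_edges G A) a" for x
      using that conn_mono[OF m] unfolding Ka mem_component_iff component_eq_iff by (blast intro: conn_sym)
    then have "(\<Union>x\<in>component G (induced_edges G A) a. component G (induced_edges G J) x) = K"
      using component_self[of a G "induced_edges G A"] by blast
    moreover have "component G (induced_edges G A) a \<in> components G A"
      using a by (simp add: components_def)
    ultimately show "K \<in> (\<lambda>K. \<Union>x\<in>K. component G (induced_edges G J) x) ` components G A"
      by blast
  qed
  also have "\<dots> \<le> card (components G A)" by (rule card_image_le[OF finite_components[OF AV]])
  finally have m_le: "card ?\<C> \<le> card (components G A)" .

  \<comment> \<open>A subgraph of a forest is a forest, in the form that nullity is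
    monotone.\<close>
  have "ncomp G (induced_edges G A) + card (induced_edges G A)
      \<le> ncomp G (induced_edges G J) + card (induced_edges G J)"
    using A(1) induced_edges_subset by (intro ncomp_plus_card_mono) (auto simp: induced_edges_def)
  also have "\<dots> \<le> card (verts G)" using nJ cJ_le indJ half by simp
  finally have "card (components G A) + card (induced_edges G A) \<le> card A"
    using ncomp_induced[OF AV] card_Diff_subset[OF fin(1)[OF AV] AV] card_mono[OF finite_verts AV]
    by simp
  then have "card (components G A) + 2 * card A \<le> card (incident_edges G A)"
    using card_incident_plus_induced[OF AV] by simp
  with few m_le show False by simp
qed

section \<open>Self-duality and 2-edge-connectivity\<close>

lemma edge_connected_imp_self_dual:
  assumes ec: "edge_connected 2 G"
  shows "identically_self_dual (verts G) (gcm_rank G)"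
proof -
  \<comment> \<open>A maximum independent subset of \<open>A\<close> extends to a basis
    \<open>B\<close>. The complement of \<open>B\<close> is independent, and its part outside
    \<open>A\<close> bounds \<open>gcm_rank G (verts G - A)\<close> from below.\<close>
  have key: "2 * gcm_rank G A + card (verts G) \<le> 2 * gcm_rank G (verts G - A) + 2 * card A"
    if A: "A \<subseteq> verts G" for A
  proof -
    obtain I where I: "I \<subseteq> A" "gcm_indep I" "card I = gcm_rank G A"
      using gcm_rank_witness[OF A] .
    obtain B where B: "I \<subseteq> B" "gcm_indep B" "2 * card B = card (verts G)"
      using gcm_basis_extension[OF ec I(2)] .
    have BV: "B \<subseteq> verts G" using B(2) by (simp add: gcm_indep_def)
    let ?D = "(verts G - B) - A"
    have "gcm_indep ?D"
      by (rule gcm_indep_subset[OF gcm_indep_complement[OF B(2,3)]]) auto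
    then have 1: "card ?D \<le> gcm_rank G (verts G - A)" by (intro card_le_gcm_rank) auto
    have fin: "finite B" "finite A" using A BV finite_vsubset by auto
    have "?D = verts G - (A \<union> B)" by blast
    then have "card (verts G) = card ?D + card (A \<union> B)"
      using card_Diff_subset[of "A \<union> B" "verts G"] card_mono[of "verts G" "A \<union> B"] A BV fin
      by simp
    moreover have "card A + card B = card (A \<union> B) + card (A \<inter> B)"
      by (rule card_Un_Int[OF fin(2,1)])
    moreover have "card I \<le> card (A \<inter> B)" using I B fin by (intro card_mono) auto
    ultimately show ?thesis using 1 I(3) B(3) by linarith
  qed
  have V: "2 * gcm_rank G (verts G) = card (verts G)"
  proof -
    have "gcm_indep {}" by (simp add: gcm_indep_def)
    then obtain B where B: "gcm_indep B" "2 * card B = card (verts G)"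
      using gcm_basis_extension[OF ec] by metis
    have "card B \<le> gcm_rank G (verts G)"
      using B by (intro card_le_gcm_rank) (auto simp: gcm_indep_def)
    moreover obtain I where "gcm_indep I" "card I = gcm_rank G (verts G)"
      using gcm_rank_witness[of "verts G"] by blast
    ultimately show ?thesis using card_gcm_indep[of I] B by simp
  qed
  show ?thesis
    unfolding identically_self_dual_def dual_rank_def
  proof (intro allI impI)
    fix A assume A: "A \<subseteq> verts G"
    have "card (verts G - A) + card A = card (verts G)"
      using card_Diff_subset[OF finite_vsubset[OF A] A] card_mono[OF finite_verts A] by simp
    moreover have "verts G - (verts G - A) = A" using A by blast
    \<comment> \<open>\<open>key\<close> for \<open>A\<close> and for its complement are the two
      opposite inequalities.\<close>
    ultimately show "int (gcm_rank G A) =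
        int (gcm_rank G (verts G - A)) + int (card A) - int (gcm_rank G (verts G))"
      using key[OF A] key[of "verts G - A"] V by simp
  qed
qed

lemma self_dual_imp_edge_connected:
  assumes sd: "identically_self_dual (verts G) (gcm_rank G)"
  shows "edge_connected 2 G"
proof (rule ccontr)
  assume "\<not> edge_connected 2 G"
  then obtain F where F: "F \<subseteq> edges G" "card F < 2" "\<not> connected_graph (delete_edges G F)"
    by (auto simp: edge_connected_def)
  then obtain u v where uv: "u \<in> verts G" "v \<in> verts G" "(u, v) \<notin> conn G (edges G - F)"
    using connected by (auto simp: connected_graph_def delete_edges_def adj_def conn_def)
  define C where "C = component G (edges G - F) u"
  have CV: "C \<subseteq> verts G" unfolding C_def using uv by (intro component_subset) auto
  have u: "u \<in> C" and v: "v \<notin> C" using uv by (auto simp: C_def mem_component_iff)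
  have bd: "boundary C \<subseteq> F" "boundary (verts G - C) \<subseteq> F"
  proof -
    have *: "e \<in> F" if "e \<in> edges G" "ends G e = {x, y}" "x \<in> C" "y \<notin> C" for e x y
      using that conn_edge[of e "edges G - F" G x y] conn_trans[of u x G "edges G - F" y]
      by (auto simp: C_def mem_component_iff)
    show "boundary C \<subseteq> F"
    proof
      fix e assume "e \<in> boundary C"
      then show "e \<in> F" by (rule boundaryE) (use *[of e] in blast)
    qed
    show "boundary (verts G - C) \<subseteq> F"
    proof
      fix e assume "e \<in> boundary (verts G - C)"
      then show "e \<in> F" by (rule boundaryE) (use * insert_commute in fast)
    qed
  qed
  obtain I where I: "gcm_indep I" "card I = gcm_rank G (verts G)"
    using gcm_rank_witness[of "verts G"] by blast
  have IV: "I \<subseteq> verts G" using I by (simp add: gcm_indep_def)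
  \<comment> \<open>With at most one cut edge and at least one component outside \<open>D\<close>,
    \<open>2 * bound D \<le> card D - 1\<close>. If \<open>I\<close> misses \<open>D\<close>,
    non-emptiness of \<open>D\<close> suffices.\<close>
  have small: "2 * card (I \<inter> D) + 1 \<le> card D"
    if D: "D \<subseteq> verts G" "D \<noteq> {}" "verts G - D \<noteq> {}" and bdD: "boundary D \<subseteq> F" for D
  proof (cases "I \<inter> D = {}")
    case True
    then show ?thesis using D finite_vsubset by (simp add: Suc_le_eq card_gt_0_iff)
  next
    case False
    then have "int (card (I \<inter> D)) \<le> bound (I \<inter> D)" using I by (auto simp: gcm_indep_bound)
    also have "\<dots> \<le> bound D" by (rule bound_mono) auto
    finally have 1: "int (card (I \<inter> D)) \<le> bound D" .
    have "components G (verts G - D) \<noteq> {}" using D(3) by (simp add: components_def)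
    then have "card (components G (verts G - D)) > 0"
      using finite_components[of "verts G - D"] by (simp add: card_gt_0_iff)
    moreover have "card (boundary D) \<le> 1"
      using card_mono[OF finite_esubset[OF F(1)] bdD] F(2) by simp
    ultimately show ?thesis using 1 bound_eq[OF D(1)] card_boundary[OF D(1)] by simp
  qed
  have "2 * card (I \<inter> C) + 1 \<le> card C" using CV u v uv bd by (intro small) auto
  moreover have "2 * card (I \<inter> (verts G - C)) + 1 \<le> card (verts G - C)"
    using CV u v uv bd by (intro small) auto
  moreover have "card C + card (verts G - C) = card (verts G)"
    using card_Diff_subset[OF finite_vsubset[OF CV] CV] card_mono[OF finite_verts CV] by simp
  moreover have "card I = card (I \<inter> C) + card (I \<inter> (verts G - C))"
  proof -
    have "I - C = I \<inter> (verts G - C)" using IV by blast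
    then show ?thesis using card_Int_Diff[OF finite_vsubset[OF IV], of C] by simp
  qed
  ultimately have "2 * gcm_rank G (verts G) < card (verts G)" using I(2) by simp
  \<comment> \<open>On the whole ground set, twice the rank equals \<open>card (verts G)\<close>
    plus the rank of the empty set, so the rank is at least half of
    \<open>card (verts G)\<close>.\<close>
  moreover have "int (gcm_rank G (verts G)) = dual_rank (verts G) (gcm_rank G) (verts G)"
    using sd unfolding identically_self_dual_def by blast
  ultimately show False by (simp add: dual_rank_def)
qed

end

theorem theorem4p5:
  fixes G :: "('v, 'e) multigraph"
  assumes "finite_multigraph G"
    and "connected_graph G"
    and "trivalent G"
  shows "identically_self_dual (verts G) (gcm_rank G) \<longleftrightarrow> edge_connected 2 G"
proof -
  interpret connected_trivalent G
    using assms by unfold_locales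
  show ?thesis
    using self_dual_imp_edge_connected edge_connected_imp_self_dual by blast
qed

end
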